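(* $[\mathbf{Txt}\mathbf{Td}\mathbf{CInd}\mathbf{Ex}_C]_{\mathbf{REC}} = [\mathbf{Txt}\mathbf{Td}\mathbf{Ex}_C]_{\mathbf{REC}}$.
   Context: Fix an acceptable numbering $(\varphi_e)_{e\in\mathbb{N}}$ of all partial computable functions. A number $e$ is a $C$-index if $\varphi_e$ is total with values in $\{0,1\}$; then $C_e=\{x:\varphi_e(x)=1\}$. $\mathbf{REC}$ is the collection of recursive subsets of $\mathbb{N}$; $\mathcal{P}$ denotes the partial computable functions. Fix a pause symbol $\#$. A text is a total function $T:\mathbb{N}\to\mathbb{N}\cup\{\#\}$, $\mathrm{content}(T)=\mathrm{range}(T)\setminus\{\#\}$, $T$ is a text for $L$ if $\mathrm{content}(T)=L$. A learner is some $h\in\mathcal{P}$, which may output a special symbol "?" meaning "no new hypothesis". Transductive hypothesis sequence: $\mathbf{Td}(h,T)(0)=?$, and for $i>0$, $\mathbf{Td}(h,T)(i)=\mathbf{Td}(h,T)(i-1)$ if $h(T(i-1))=?$, else $h(T(i-1))$. Restrictions on hypothesis sequence $p$ and text $T$: $\mathbf{Ex}_C$: there is $n_0$ with $p(n)=p(n_0)$ for all $n\ge n_0$ and $p(n_0)$ a $C$-index with $C_{p(n_0)}=\mathrm{content}(T)$; $\mathbf{CInd}$: for all $i$, $p(i)$ is a $C$-index. Juxtaposition means conjunction. $h$ $\mathbf{Txt}\beta\delta$-learns $L$ iff $\delta(\beta(h,T),T)$ holds for every text $T$ for $L$; $[\mathbf{Txt}\beta\delta]_{\mathbf{REC}}$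 is the set of all classes $\mathcal{L}\subseteq\mathbf{REC}$ for which some $h\in\mathcal{P}$ learns every $L\in\mathcal{L}$.
   Formalization: CInd is read as requiring each p(i) to be either "?" or a C-index; read literally it could never hold, since Td(h,T)(0)=? is not a C-index, and the equality would then fail for the class containing only the set of all natural numbers. *)

theory Defs
  imports Main
begin

section \<open>Partial computable functions\<close>

datatype recf =
    Zero
  | Succ
  | Proj nat
  | Comp recf "recf list"
  | Prec recf recf
  | Mu recf

text \<open>
  Big-step semantics of Kleene's mu-recursive functions. A term carries no fixed arity: it is
  evaluated on an argument list, and a projection beyond the end of the list is undefined.
  Minimisation requires all smaller arguments to give a defined, nonzero value.
\<close>

inductive computes :: "recf \<Rightarrow> nat list \<Rightarrow> nat \<Rightarrow> bool" where
  zero: "computes Zero xs 0"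
| succ: "computes Succ (x # xs) (Suc x)"
| proj: "i < length xs \<Longrightarrow> computes (Proj i) xs (xs ! i)"
| comp: "list_all2 (\<lambda>g y. computes g xs y) gs ys \<Longrightarrow> computes f ys z \<Longrightarrow>
    computes (Comp f gs) xs z"
| prec_0: "computes f xs y \<Longrightarrow> computes (Prec f g) (0 # xs) y"
| prec_Suc: "computes (Prec f g) (n # xs) r \<Longrightarrow> computes g (n # r # xs) y \<Longrightarrow>
    computes (Prec f g) (Suc n # xs) y"
| mu: "computes f (n # xs) 0 \<Longrightarrow> \<forall>m<n. \<exists>y. computes f (m # xs) (Suc y) \<Longrightarrow>
    computes (Mu f) xs n"

inductive_cases computes_ZeroE: "computes Zero xs y"
inductive_cases computes_SuccE: "computes Succ xs y"
inductive_cases computes_ProjE: "computes (Proj i) xs y"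
inductive_cases computes_CompE: "computes (Comp f gs) xs y"
inductive_cases computes_Prec_0E: "computes (Prec f g) (0 # xs) y"
inductive_cases computes_Prec_SucE: "computes (Prec f g) (Suc n # xs) y"
inductive_cases computes_MuE: "computes (Mu f) xs y"

lemma computes_deterministic: "computes f xs y \<Longrightarrow> computes f xs z \<Longrightarrow> y = z"
proof (induction arbitrary: z rule: computes.induct)
  case (zero xs)
  then show ?case by (rule computes_ZeroE) simp
next
  case (succ x xs)
  then show ?case by (rule computes_SuccE) simp
next
  case (proj i xs)
  from proj.prems show ?case by (rule computes_ProjE) simp
next
  case (comp xs gs ys f w)
  from comp.prems obtain zs where zs: "list_all2 (\<lambda>g y. computes g xs y) gs zs" "computes f zs z"
    by (rule computes_CompE)
  have "ys = zs"
  proof (rule nth_equalityI)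
    show "length ys = length zs"
      using comp.IH(1) zs(1) by (simp add: list_all2_conv_all_nth)
    show "ys ! i = zs ! i" if "i < length ys" for i
      using comp.IH(1) zs(1) that by (simp add: list_all2_conv_all_nth)
  qed
  then show ?case
    using comp.IH(2) zs(2) by blast
next
  case (prec_0 f xs y g)
  from prec_0.prems have "computes f xs z" by (rule computes_Prec_0E)
  then show ?case by (rule prec_0.IH)
next
  case (prec_Suc f g n xs r y)
  from prec_Suc.prems obtain r' where r': "computes (Prec f g) (n # xs) r'" "computes g (n # r' # xs) z"
    by (rule computes_Prec_SucE)
  from r'(1) have "r = r'" by (rule prec_Suc.IH(1))
  with r'(2) show ?case by (simp add: prec_Suc.IH(2))
next
  case (mu f n xs)
  from mu.prems have z: "computes f (z # xs) 0" "\<forall>m<z. \<exists>y. computes f (m # xs) (Suc y)"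
    by (rule computes_MuE, blast)+
  show ?case
  proof (rule linorder_cases[of n z])
    assume "n < z"
    with z(2) obtain y where "computes f (n # xs) (Suc y)" by blast
    then have "0 = Suc y" by (rule mu.IH(1))
    then show ?thesis by simp
  next
    assume "z < n"
    then obtain y where "\<forall>w. computes f (z # xs) w \<longrightarrow> Suc y = w" using mu.IH(2) by blast
    then have "Suc y = 0" using z(1) by blast
    then show ?thesis by simp
  qed simp
qed

definition partial_computable :: "(nat \<rightharpoonup> nat) \<Rightarrow> bool" where
  "partial_computable f \<longleftrightarrow> (\<exists>c. \<forall>x y. f x = Some y \<longleftrightarrow> computes c [x] y)"

definition partial_computable2 :: "(nat \<Rightarrow> nat \<rightharpoonup> nat) \<Rightarrow> bool" where
  "partial_computable2 f \<longleftrightarrow> (\<exists>c. \<forall>x y z. f x y = Some z \<longleftrightarrow> computes c [x, y] z)"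

definition total_computable :: "(nat \<Rightarrow> nat) \<Rightarrow> bool" where
  "total_computable f \<longleftrightarrow> partial_computable (\<lambda>x. Some (f x))"

text \<open>
  Acceptable numberings in the sense of Rogers: a numbering of all unary partial computable
  functions that has a computable universal function and into which every other computable
  numbering can be effectively translated.
\<close>

definition acceptable_numbering :: "(nat \<Rightarrow> nat \<rightharpoonup> nat) \<Rightarrow> bool" where
  "acceptable_numbering \<phi> \<longleftrightarrow>
     range \<phi> = {f. partial_computable f} \<and>
     partial_computable2 \<phi> \<and>
     (\<forall>\<psi>. partial_computable2 \<psi> \<longrightarrow> (\<exists>s. total_computable s \<and> (\<forall>e. \<phi> (s e) = \<psi> e)))"

definition REC :: "nat set set" where
  "REC = {L. total_computable (\<lambda>x. if x \<in> L then 1 else 0)}"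

definition C_index :: "(nat \<Rightarrow> nat \<rightharpoonup> nat) \<Rightarrow> nat \<Rightarrow> bool" where
  "C_index \<phi> e \<longleftrightarrow> (\<forall>x. \<exists>y\<in>{0, 1}. \<phi> e x = Some y)"

definition C_set :: "(nat \<Rightarrow> nat \<rightharpoonup> nat) \<Rightarrow> nat \<Rightarrow> nat set" where
  "C_set \<phi> e = {x. \<phi> e x = Some 1}"

section \<open>Texts and learners\<close>

text \<open>\<open>Pause\<close> is the pause symbol \<open>#\<close>; \<open>Quest\<close> is the symbol \<open>?\<close> (no new hypothesis).\<close>

datatype datum = Pause | Elem nat

datatype conjecture = Quest | Hyp nat

type_synonym text_seq = "nat \<Rightarrow> datum"

definition content :: "text_seq \<Rightarrow> nat set" where
  "content T = {x. Elem x \<in> range T}"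

definition text_for :: "text_seq \<Rightarrow> nat set \<Rightarrow> bool" where
  "text_for T L \<longleftrightarrow> content T = L"

text \<open>
  Learners are partial functions, \<open>None\<close> standing for divergence. Their computability is that of
  the function on natural numbers obtained by coding the two extra symbols as \<open>0\<close>.
\<close>

type_synonym learner = "datum \<rightharpoonup> conjecture"

fun datum_encode :: "datum \<Rightarrow> nat" where
  "datum_encode Pause = 0"
| "datum_encode (Elem x) = Suc x"

fun conjecture_encode :: "conjecture \<Rightarrow> nat" where
  "conjecture_encode Quest = 0"
| "conjecture_encode (Hyp e) = Suc e"

definition computable_learner :: "learner \<Rightarrow> bool" where
  "computable_learner h \<longleftrightarrow>
     (\<exists>f. partial_computable f \<and>
          (\<forall>d. f (datum_encode d) = map_option conjecture_encode (h d)))"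

text \<open>A hypothesis sequence is undefined wherever the learner diverges.\<close>

type_synonym hyp_seq = "nat \<rightharpoonup> conjecture"

fun Td :: "learner \<Rightarrow> text_seq \<Rightarrow> hyp_seq" where
  "Td h T 0 = Some Quest"
| "Td h T (Suc i) = (if h (T i) = Some Quest then Td h T i else h (T i))"

type_synonym restriction = "hyp_seq \<Rightarrow> text_seq \<Rightarrow> bool"

definition Ex_C :: "(nat \<Rightarrow> nat \<rightharpoonup> nat) \<Rightarrow> restriction" where
  "Ex_C \<phi> p T \<longleftrightarrow>
     (\<exists>n0. (\<forall>n\<ge>n0. p n = p n0) \<and>
           (\<exists>e. p n0 = Some (Hyp e) \<and> C_index \<phi> e \<and> C_set \<phi> e = content T))"

text \<open>
  The symbol \<open>?\<close> is not a hypothesis and therefore exempt: a transductive hypothesis sequence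
  always begins with it. An undefined entry does violate the restriction.
\<close>

definition CInd :: "(nat \<Rightarrow> nat \<rightharpoonup> nat) \<Rightarrow> restriction" where
  "CInd \<phi> p T \<longleftrightarrow> (\<forall>i. p i = Some Quest \<or> (\<exists>e. p i = Some (Hyp e) \<and> C_index \<phi> e))"

definition restr_conj :: "restriction \<Rightarrow> restriction \<Rightarrow> restriction" where
  "restr_conj \<delta> \<delta>' p T \<longleftrightarrow> \<delta> p T \<and> \<delta>' p T"

definition Txt_learns ::
    "(learner \<Rightarrow> text_seq \<Rightarrow> hyp_seq) \<Rightarrow> restriction \<Rightarrow> learner \<Rightarrow> nat set \<Rightarrow> bool" where
  "Txt_learns \<beta> \<delta> h L \<longleftrightarrow> (\<forall>T. text_for T L \<longrightarrow> \<delta> (\<beta> h T) T)"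

definition Txt_REC ::
    "(learner \<Rightarrow> text_seq \<Rightarrow> hyp_seq) \<Rightarrow> restriction \<Rightarrow> nat set set set" where
  "Txt_REC \<beta> \<delta> =
     {\<L>. \<L> \<subseteq> REC \<and> (\<exists>h. computable_learner h \<and> (\<forall>L\<in>\<L>. Txt_learns \<beta> \<delta> h L))}"

end

theory Submission
  imports Defs
begin

text \<open>
  A transductive learner reacts to each datum in isolation, and every datum of a text for \<open>L\<close> may be
  repeated infinitely often without changing the content. Hence whatever hypothesis the learner ever
  issues on a datum of \<open>L\<close> is already its final, correct one on some other text for \<open>L\<close>, so it is a
  \<open>C\<close>-index and the same learner satisfies \<open>CInd\<close>.
\<close>

lemma Txt_learns_Td_Ex_C_datum:
  assumes learns: "Txt_learns Td (Ex_C \<phi>) h L" and T: "text_for T L" and d: "d \<in> range T"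
  shows "h d = Some Quest \<or> (\<exists>e. h d = Some (Hyp e) \<and> C_index \<phi> e)"
proof (cases "h d = Some Quest")
  case False
  \<comment> \<open>Even positions replay \<open>T\<close>, which keeps the content; odd ones insert
    \<open>d\<close>, so \<open>d\<close> recurs past every bound.\<close>
  define T' where "T' i = (if even i then T (i div 2) else d)" for i
  have "T i \<in> range T'" for i
    by (rule range_eqI[of _ _ "2 * i"]) (simp add: T'_def)
  moreover have "range T' \<subseteq> range T"
    using d by (auto simp: T'_def)
  ultimately have "range T' = range T"
    by blast
  then have "text_for T' L"
    using T by (simp add: text_for_def content_def)
  then have "Ex_C \<phi> (Td h T') T'"
    using learns by (simp add: Txt_learns_def)
  then obtain n0 e where n0: "\<And>n. n \<ge> n0 \<Longrightarrow> Td h T' n = Td h T' n0"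
    and e: "Td h T' n0 = Some (Hyp e)" "C_index \<phi> e"
    unfolding Ex_C_def by blast
  \<comment> \<open>Position \<open>2 * n0 + 1\<close> is odd and beyond \<open>n0\<close>: the
    entry after it is \<open>h d\<close> itself, even if undefined, and must equal the
    limit.\<close>
  have "h d = Td h T' (Suc (2 * n0 + 1))"
    using False by (simp add: T'_def)
  also have "\<dots> = Some (Hyp e)"
    using n0[of "Suc (2 * n0 + 1)"] e(1) by (simp del: Td.simps)
  finally show ?thesis
    using e(2) by blast
qed simp

lemma Txt_learns_Td_Ex_C_imp_CInd:
  assumes "Txt_learns Td (Ex_C \<phi>) h L"
  shows "Txt_learns Td (CInd \<phi>) h L"
  unfolding Txt_learns_def CInd_def
proof (intro allI impI)
  fix T i
  assume T: "text_for T L"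
  show "Td h T i = Some Quest \<or> (\<exists>e. Td h T i = Some (Hyp e) \<and> C_index \<phi> e)"
  proof (induction i)
    case (Suc i)
    \<comment> \<open>The new entry is either the previous one or \<open>h (T i)\<close>.\<close>
    then show ?case
      using Txt_learns_Td_Ex_C_datum[OF assms T, of "T i"] by auto
  qed simp
qed

theorem theorem9:
  fixes \<phi> :: "nat \<Rightarrow> nat \<rightharpoonup> nat"
  assumes "acceptable_numbering \<phi>"
  shows "Txt_REC Td (restr_conj (CInd \<phi>) (Ex_C \<phi>)) = Txt_REC Td (Ex_C \<phi>)"
proof -
  \<comment> \<open>The equivalence is per learner, so the same \<open>h\<close> serves both
    classes.\<close>
  have "Txt_learns Td (restr_conj (CInd \<phi>) (Ex_C \<phi>)) h L \<longleftrightarrow> Txt_learns Td (Ex_C \<phi>) h L" for h L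
    using Txt_learns_Td_Ex_C_imp_CInd[of \<phi> h L] by (auto simp: Txt_learns_def restr_conj_def)
  then show ?thesis
    by (simp add: Txt_REC_def)
qed

end
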